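(* Let $I:=\{1,\ldots,m\}$ and $U:=\sum_{i=1}^m\omega_iU_i$, where $U_i\colon\mathcal H\to\mathcal H$ is $\rho_i$-strongly quasi-nonexpansive for $i\in I$. Assume that $\rho:=\min_{i\in I}\rho_i>0$, $\omega:=\min_{i\in I}\omega_i>0$, $\sum_{i\in I}\omega_i=1$ and $F_0:=\bigcap_{i\in I}\operatorname{Fix}U_i\ne\emptyset$. Let $S\subseteq\mathcal H$ be nonempty and bounded. (i) Suppose that for every $i\in I$, $U_i$ is weakly regular over $S$. Then $U$ is weakly regular over $S$. (ii) Suppose that for every $i\in I$, $U_i$ is regular over $S$ and the family $\{\operatorname{Fix}U_i\mid i\in I\}$ is regular over $S$. Then $U$ is regular over $S$. (iii) Suppose that for every $i\in I$, $U_i$ is linearly regular over $S$ with modulus $\delta_i$, let $\delta:=\min_{i\in I}\delta_i>0$, and suppose that the family $\{\operatorname{Fix}U_i\mid i\in I\}$ is linearly regular over $S$ with modulus $\kappa>0$. Then $U$ is linearly regular over $S$ with modulus $2\kappa^2\delta^2/(\omega\rho)$.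
   Context: $\mathcal H$ is a real Hilbert space, $\operatorname{Fix}U:=\{x\in\mathcal H\mid Ux=x\}$, and $d(x,C):=\inf_{y\in C}\|x-y\|$. For $\rho\ge 0$, an operator $T\colon\mathcal H\to\mathcal H$ is $\rho$-strongly quasi-nonexpansive if $\operatorname{Fix}T\ne\emptyset$ and $\|Tu-z\|^2\le\|u-z\|^2-\rho\|Tu-u\|^2$ for all $u\in\mathcal H$, $z\in\operatorname{Fix}T$; it is quasi-nonexpansive if this holds with $\rho=0$ (in that case $\operatorname{Fix}T$ is closed and convex). Regular operators. Let $S\subseteq\mathcal H$ be nonempty. A quasi-nonexpansive operator $V\colon\mathcal H\to\mathcal H$ is: (a) weakly regular over $S$ if for every sequence $\{x^k\}_{k=0}^\infty\subseteq S$ and every strictly increasing sequence $\{n_k\}$ of nonnegative integers, $x^{n_k}\rightharpoonup y$ (weakly) and $\|Vx^k-x^k\|\to 0$ imply $y\in\operatorname{Fix}V$; (b) regular over $S$ if for every sequence $\{x^k\}_{k=0}^\infty\subseteq S$, $\|Vx^k-x^k\|\to 0$ implies $d(x^k,\operatorname{Fix}V)\to 0$; (c) linearly regular over $S$ with modulus $\delta>0$ if $d(x,\operatorname{Fix}V)\le\delta\|Vx-x\|$ for all $x\in S$. Regular families of sets. A family of closed convex sets $C_i$, $i\in I=\{1,\ldots,m\}$, with $C=\bigcap_{i\in I}C_i\neq\emptyset$ is regular over $S$ if for every sequence $\{x^k\}_{k=0}^\infty\subseteq S$, $\max_{i\in I}d(x^k,C_i)\to 0$ implies $d(x^k,C)\to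 0$; it is linearly regular over $S$ with modulus $\kappa>0$ if $d(x,C)\le\kappa\max_{i\in I}d(x,C_i)$ for all $x\in S$.
   Formalization: In part (iii), δ is the maximum of the δ_i instead of the minimum; with the minimum the claim is false, e.g. for U_1 = id with δ_1 = 1/10 and U_2 x = x/2 with δ_2 = 2 on the real line, S = {1}, equal weights, κ = 1. *)

theory Defs
  imports "HOL-Analysis.Analysis"
begin

definition Fix :: "('a \<Rightarrow> 'a) \<Rightarrow> 'a set" where
  "Fix U = {x. U x = x}"

definition weakly_tendsto :: "(nat \<Rightarrow> 'a::real_normed_vector) \<Rightarrow> 'a \<Rightarrow> bool" where
  "weakly_tendsto x y \<longleftrightarrow>
     (\<forall>f :: 'a \<Rightarrow> real. bounded_linear f \<longrightarrow> (\<lambda>n. f (x n)) \<longlonglongrightarrow> f y)"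

definition strongly_quasi_nonexpansive ::
    "real \<Rightarrow> ('a::real_normed_vector \<Rightarrow> 'a) \<Rightarrow> bool" where
  "strongly_quasi_nonexpansive \<rho> T \<longleftrightarrow>
     0 \<le> \<rho> \<and> Fix T \<noteq> {} \<and>
     (\<forall>u. \<forall>z\<in>Fix T. (norm (T u - z))\<^sup>2 \<le> (norm (u - z))\<^sup>2 - \<rho> * (norm (T u - u))\<^sup>2)"

definition quasi_nonexpansive :: "('a::real_normed_vector \<Rightarrow> 'a) \<Rightarrow> bool" where
  "quasi_nonexpansive T \<longleftrightarrow> strongly_quasi_nonexpansive 0 T"

(* The notions of regularity below are only meant for a nonempty set S and a quasi-nonexpansive
   operator V (respectively a finite family of closed convex sets with a common point).  These
   standing requirements are part of the definitions.  In particular Fix V, C i and the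
   intersection are nonempty, so infdist is the usual infimum and never its default value 0. *)

definition weakly_regular_over :: "'a::real_normed_vector set \<Rightarrow> ('a \<Rightarrow> 'a) \<Rightarrow> bool" where
  "weakly_regular_over S V \<longleftrightarrow>
     S \<noteq> {} \<and> quasi_nonexpansive V \<and>
     (\<forall>(x :: nat \<Rightarrow> 'a) (n :: nat \<Rightarrow> nat) y.
        range x \<subseteq> S \<and> strict_mono n \<and> weakly_tendsto (\<lambda>k. x (n k)) y \<and>
        (\<lambda>k. norm (V (x k) - x k)) \<longlonglongrightarrow> 0 \<longrightarrow> y \<in> Fix V)"

definition regular_over :: "'a::real_normed_vector set \<Rightarrow> ('a \<Rightarrow> 'a) \<Rightarrow> bool" where
  "regular_over S V \<longleftrightarrow>
     S \<noteq> {} \<and> quasi_nonexpansive V \<and>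
     (\<forall>x :: nat \<Rightarrow> 'a.
        range x \<subseteq> S \<and> (\<lambda>k. norm (V (x k) - x k)) \<longlonglongrightarrow> 0 \<longrightarrow>
        (\<lambda>k. infdist (x k) (Fix V)) \<longlonglongrightarrow> 0)"

(* A modulus is any admissible constant, not the least one: if V has modulus \<delta>, then it
   has every larger modulus.  A common modulus for finitely many operators with moduli
   \<delta> i is thus the maximum (not the minimum) of the \<delta> i. *)
definition linearly_regular_over ::
    "'a::real_normed_vector set \<Rightarrow> real \<Rightarrow> ('a \<Rightarrow> 'a) \<Rightarrow> bool" where
  "linearly_regular_over S \<delta> V \<longleftrightarrow>
     S \<noteq> {} \<and> quasi_nonexpansive V \<and> 0 < \<delta> \<and>
     (\<forall>x\<in>S. infdist x (Fix V) \<le> \<delta> * norm (V x - x))"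

definition closed_convex_family ::
    "'i set \<Rightarrow> ('i \<Rightarrow> 'a::real_normed_vector set) \<Rightarrow> bool" where
  "closed_convex_family I C \<longleftrightarrow>
     finite I \<and> I \<noteq> {} \<and> (\<forall>i\<in>I. closed (C i) \<and> convex (C i)) \<and> (\<Inter>i\<in>I. C i) \<noteq> {}"

definition family_regular_over ::
    "'a::real_normed_vector set \<Rightarrow> 'i set \<Rightarrow> ('i \<Rightarrow> 'a set) \<Rightarrow> bool" where
  "family_regular_over S I C \<longleftrightarrow>
     S \<noteq> {} \<and> closed_convex_family I C \<and>
     (\<forall>x :: nat \<Rightarrow> 'a.
        range x \<subseteq> S \<and> (\<lambda>k. MAX i\<in>I. infdist (x k) (C i)) \<longlonglongrightarrow> 0 \<longrightarrow>
        (\<lambda>k. infdist (x k) (\<Inter>i\<in>I. C i)) \<longlonglongrightarrow> 0)"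

definition family_linearly_regular_over ::
    "'a::real_normed_vector set \<Rightarrow> real \<Rightarrow> 'i set \<Rightarrow> ('i \<Rightarrow> 'a set) \<Rightarrow> bool" where
  "family_linearly_regular_over S \<kappa> I C \<longleftrightarrow>
     S \<noteq> {} \<and> closed_convex_family I C \<and> 0 < \<kappa> \<and>
     (\<forall>x\<in>S. infdist x (\<Inter>i\<in>I. C i) \<le> \<kappa> * (MAX i\<in>I. infdist x (C i)))"

end

theory Submission
  imports Defs
begin

text \<open>
  Everything rests on one inequality. Let \<open>z\<close> be a common fixed point of the operators
  \<open>T i\<close>, and let \<open>U\<close> be their average with weights \<open>w i\<close>. Convexity of the squared norm
  passes strong quasi-nonexpansiveness on to \<open>U\<close> with all the displacement terms kept
  (\<open>average_decrease\<close>):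
  \<open>\<parallel>U x - z\<parallel>\<^sup>2 \<le> \<parallel>x - z\<parallel>\<^sup>2 - (\<Sum>i. w i * r i * \<parallel>T i x - x\<parallel>\<^sup>2)\<close>.
  On the other hand, the distance to \<open>z\<close> can only drop a lot if \<open>U\<close> moves \<open>x\<close> a lot: expanding
  the square gives \<open>\<parallel>x - z\<parallel>\<^sup>2 - \<parallel>U x - z\<parallel>\<^sup>2 \<le> 2 * \<parallel>x - z\<parallel> * \<parallel>U x - x\<parallel>\<close>. Together
  these bound every single displacement \<open>\<parallel>T i x - x\<parallel>\<^sup>2\<close> by a multiple of
  \<open>\<parallel>x - z\<parallel> * \<parallel>U x - x\<parallel>\<close> (\<open>displacement_le\<close>).

  All three claims are readings of this bound. Applied to a fixed point of \<open>U\<close>, it shows that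
  \<open>Fix U\<close> is the intersection of the sets \<open>Fix (T i)\<close>. On a bounded set \<open>\<parallel>x - z\<parallel>\<close> is bounded
  for fixed \<open>z\<close>, so \<open>\<parallel>U (x k) - x k\<parallel> \<longlonglongrightarrow> 0\<close> forces \<open>\<parallel>T i (x k) - x k\<parallel> \<longlonglongrightarrow> 0\<close> for every
  \<open>i\<close>, which transfers weak regularity and regularity to \<open>U\<close>. For linear regularity one
  takes the infimum over \<open>z\<close> instead: with \<open>d\<close> the distance from \<open>x\<close> to \<open>Fix U\<close>, the
  hypotheses turn the bound into \<open>d\<^sup>2 \<le> K * d * \<parallel>U x - x\<parallel>\<close>, and one factor \<open>d\<close> cancels; \<open>K\<close> is the claimed modulus.
\<close>

section \<open>Auxiliary inequalities\<close>

lemma norm_convex_combination_squared_le: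
  fixes v :: "'i \<Rightarrow> 'a::real_normed_vector"
  assumes "finite I" "\<And>i. i \<in> I \<Longrightarrow> 0 \<le> w i" "(\<Sum>i\<in>I. w i) = 1"
  shows "(norm (\<Sum>i\<in>I. w i *\<^sub>R v i))\<^sup>2 \<le> (\<Sum>i\<in>I. w i * (norm (v i))\<^sup>2)"
proof -
  have "I \<noteq> {}" using assms(3) by auto
  have "norm (\<Sum>i\<in>I. w i *\<^sub>R v i) \<le> (\<Sum>i\<in>I. norm (w i *\<^sub>R v i))"
    by (rule norm_sum)
  also have "\<dots> = (\<Sum>i\<in>I. w i * norm (v i))"
    using assms(2) by (intro sum.cong) auto
  finally have "(norm (\<Sum>i\<in>I. w i *\<^sub>R v i))\<^sup>2 \<le> (\<Sum>i\<in>I. w i * norm (v i))\<^sup>2"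
    by (intro power_mono) auto
  also have "\<dots> \<le> (\<Sum>i\<in>I. w i * (norm (v i))\<^sup>2)"
    using convex_on_sum[OF \<open>finite I\<close> \<open>I \<noteq> {}\<close> convex_power2 assms(3,2), of "\<lambda>i. norm (v i)"]
    by simp
  finally show ?thesis .
qed

lemma norm_diff_squared_le:
  fixes x y z :: "'a::real_inner"
  shows "(norm (x - z))\<^sup>2 - (norm (y - z))\<^sup>2 \<le> 2 * norm (x - z) * norm (y - x)"
proof -
  have "(norm (x - z))\<^sup>2 - (norm (y - z))\<^sup>2 = 2 * ((x - z) \<bullet> (x - y)) - (norm (y - x))\<^sup>2"
    by (simp add: power2_norm_eq_inner algebra_simps inner_commute)
  also have "\<dots> \<le> 2 * ((x - z) \<bullet> (x - y))"
    by simp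
  also have "\<dots> \<le> 2 * (norm (x - z) * norm (x - y))"
    by (intro mult_left_mono norm_cauchy_schwarz) auto
  finally show ?thesis
    by (simp add: norm_minus_commute mult.assoc)
qed

text \<open>Lets a displacement bound that holds for every common fixed point pass to the distance
  from their whole set.\<close>

lemma le_mult_infdist:
  fixes x :: "'a::metric_space"
  assumes "A \<noteq> {}" "0 \<le> a" "\<And>z. z \<in> A \<Longrightarrow> c \<le> a * dist x z"
  shows "c \<le> a * infdist x A"
proof (cases "a = 0")
  case True
  then show ?thesis using assms(1,3) by auto
next
  case False
  with assms(2) have "0 < a" by simp
  have "c / a \<le> infdist x A"
    unfolding infdist_notempty[OF assms(1)]
    using assms(1,3) \<open>0 < a\<close> by (intro cINF_greatest) (auto simp: field_simps)
  with \<open>0 < a\<close> show ?thesis by (simp add: field_simps)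
qed

lemma tendsto_zero_MAX:
  fixes f :: "'i \<Rightarrow> 'b \<Rightarrow> real"
  assumes "finite I" "I \<noteq> {}"
    and "\<And>i. i \<in> I \<Longrightarrow> (f i \<longlongrightarrow> 0) F" "\<And>i k. i \<in> I \<Longrightarrow> 0 \<le> f i k"
  shows "((\<lambda>k. MAX i\<in>I. f i k) \<longlongrightarrow> 0) F"
proof (rule tendsto_sandwich)
  obtain j where "j \<in> I" using assms(2) by blast
  then have "0 \<le> (MAX i\<in>I. f i k)" for k
    using assms(1,4) by (subst Max_ge_iff) auto
  then show "\<forall>\<^sub>F k in F. 0 \<le> (MAX i\<in>I. f i k)" by simp
  have "(MAX i\<in>I. f i k) \<le> (\<Sum>i\<in>I. f i k)" for k
    using assms(1,2,4) by (subst Max_le_iff) (auto intro: member_le_sum)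
  then show "\<forall>\<^sub>F k in F. (MAX i\<in>I. f i k) \<le> (\<Sum>i\<in>I. f i k)" by simp
  show "((\<lambda>k. \<Sum>i\<in>I. f i k) \<longlongrightarrow> 0) F"
    using tendsto_sum[of I f "\<lambda>_. 0" F] assms(3) by simp
qed auto

section \<open>Convex combinations of strongly quasi-nonexpansive operators\<close>

context
  fixes T :: "'i \<Rightarrow> 'a::real_inner \<Rightarrow> 'a" and U :: "'a \<Rightarrow> 'a"
    and I :: "'i set" and w r :: "'i \<Rightarrow> real" and \<omega> \<rho> :: real
  assumes fin: "finite I"
    and U: "\<And>x. U x = (\<Sum>i\<in>I. w i *\<^sub>R T i x)"
    and sqne: "\<And>i. i \<in> I \<Longrightarrow> strongly_quasi_nonexpansive (r i) (T i)"
    and \<omega>: "0 < \<omega>" "\<And>i. i \<in> I \<Longrightarrow> \<omega> \<le> w i"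
    and \<rho>: "0 < \<rho>" "\<And>i. i \<in> I \<Longrightarrow> \<rho> \<le> r i"
    and sum_w: "(\<Sum>i\<in>I. w i) = 1"
    and common: "(\<Inter>i\<in>I. Fix (T i)) \<noteq> {}"
begin

lemma weight_nonneg: "i \<in> I \<Longrightarrow> 0 \<le> w i"
  using \<omega> by force

lemma constant_nonneg: "i \<in> I \<Longrightarrow> 0 \<le> r i"
  using \<rho> by force

lemma index_nonempty: "I \<noteq> {}"
  using sum_w by auto

lemma average_decrease:
  assumes z: "z \<in> (\<Inter>i\<in>I. Fix (T i))"
  shows "(norm (U x - z))\<^sup>2
    \<le> (norm (x - z))\<^sup>2 - (\<Sum>i\<in>I. w i * r i * (norm (T i x - x))\<^sup>2)"
proof -
  (* The weights sum to 1, so z is its own average. *)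
  have "U x - z = (\<Sum>i\<in>I. w i *\<^sub>R (T i x - z))"
    by (simp add: U scaleR_right_diff_distrib sum_subtractf scaleR_left.sum[symmetric] sum_w)
  then have "(norm (U x - z))\<^sup>2 \<le> (\<Sum>i\<in>I. w i * (norm (T i x - z))\<^sup>2)"
    using norm_convex_combination_squared_le[OF fin weight_nonneg sum_w] by simp
  also have "\<dots> \<le> (\<Sum>i\<in>I. w i * ((norm (x - z))\<^sup>2 - r i * (norm (T i x - x))\<^sup>2))"
    using z sqne weight_nonneg
    by (intro sum_mono mult_left_mono) (auto simp: strongly_quasi_nonexpansive_def)
  also have "\<dots> = (norm (x - z))\<^sup>2 - (\<Sum>i\<in>I. w i * r i * (norm (T i x - x))\<^sup>2)"
    by (simp add: right_diff_distrib sum_subtractf sum_distrib_right[symmetric] sum_w mult.assoc)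
  finally show ?thesis .
qed

text \<open>
  The decrease of the distance to \<open>z\<close> dominates each displacement term separately, and is itself
  dominated by the displacement of \<open>U\<close>.
\<close>

lemma displacement_le:
  assumes z: "z \<in> (\<Inter>i\<in>I. Fix (T i))" and i: "i \<in> I"
  shows "\<omega> * \<rho> * (norm (T i x - x))\<^sup>2 \<le> 2 * norm (x - z) * norm (U x - x)"
proof -
  have "\<omega> * \<rho> * (norm (T i x - x))\<^sup>2 \<le> w i * r i * (norm (T i x - x))\<^sup>2"
    using i \<omega> \<rho> weight_nonneg by (intro mult_right_mono mult_mono) auto
  also have "\<dots> \<le> (\<Sum>i\<in>I. w i * r i * (norm (T i x - x))\<^sup>2)"
    using i fin weight_nonneg constant_nonneg
    by (intro member_le_sum[where f = "\<lambda>i. w i * r i * (norm (T i x - x))\<^sup>2"]) auto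
  also have "\<dots> \<le> (norm (x - z))\<^sup>2 - (norm (U x - z))\<^sup>2"
    using average_decrease[OF z, of x] by simp
  also have "\<dots> \<le> 2 * norm (x - z) * norm (U x - x)"
    by (rule norm_diff_squared_le)
  finally show ?thesis .
qed

lemma Fix_average: "Fix U = (\<Inter>i\<in>I. Fix (T i))"
proof
  show "(\<Inter>i\<in>I. Fix (T i)) \<subseteq> Fix U"
    by (auto simp: Fix_def U scaleR_left.sum[symmetric] sum_w)
  obtain z where z: "z \<in> (\<Inter>i\<in>I. Fix (T i))" using common by blast
  show "Fix U \<subseteq> (\<Inter>i\<in>I. Fix (T i))"
  proof (intro subsetI INT_I)
    fix x i assume "x \<in> Fix U" "i \<in> I"
    then have "\<omega> * \<rho> * (norm (T i x - x))\<^sup>2 \<le> 0"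
      using displacement_le[OF z, of i x] by (simp add: Fix_def)
    moreover have "0 < \<omega> * \<rho>" using \<omega>(1) \<rho>(1) by simp
    ultimately have "(norm (T i x - x))\<^sup>2 \<le> 0"
      by (metis mult_le_cancel_left_pos mult_zero_right)
    then show "x \<in> Fix (T i)" by (simp add: Fix_def)
  qed
qed

lemma quasi_nonexpansive_average: "quasi_nonexpansive U"
proof -
  have "(norm (U x - z))\<^sup>2 \<le> (norm (x - z))\<^sup>2" if "z \<in> (\<Inter>i\<in>I. Fix (T i))" for x z
  proof -
    have "0 \<le> (\<Sum>i\<in>I. w i * r i * (norm (T i x - x))\<^sup>2)"
      using weight_nonneg constant_nonneg by (intro sum_nonneg) auto
    then show ?thesis using average_decrease[OF that, of x] by linarith
  qed
  then show ?thesis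
    using common by (simp add: quasi_nonexpansive_def strongly_quasi_nonexpansive_def Fix_average)
qed

section \<open>Transfer of regularity to the average\<close>

text \<open>
  Boundedness of \<open>S\<close> is what makes the factor \<open>\<parallel>x k - z\<parallel>\<close> in the displacement bound harmless.
\<close>

lemma displacement_tendsto_zero:
  assumes "bounded S" "range x \<subseteq> S" "i \<in> I"
    and lim: "(\<lambda>k::nat. norm (U (x k) - x k)) \<longlonglongrightarrow> 0"
  shows "(\<lambda>k. norm (T i (x k) - x k)) \<longlonglongrightarrow> 0"
proof -
  obtain z where z: "z \<in> (\<Inter>i\<in>I. Fix (T i))" using common by blast
  obtain B where B: "\<And>y. y \<in> S \<Longrightarrow> dist z y \<le> B"
    using \<open>bounded S\<close> unfolding bounded_any_center[where a = z] by blast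
  have upper: "(norm (T i (x k) - x k))\<^sup>2 \<le> 2 * B / (\<omega> * \<rho>) * norm (U (x k) - x k)" for k
  proof -
    have "norm (x k - z) \<le> B"
      using B[of "x k"] assms(2) by (auto simp: dist_norm norm_minus_commute)
    then have "2 * norm (x k - z) * norm (U (x k) - x k) \<le> 2 * B * norm (U (x k) - x k)"
      by (intro mult_right_mono) auto
    with displacement_le[OF z \<open>i \<in> I\<close>, of "x k"]
    have "\<omega> * \<rho> * (norm (T i (x k) - x k))\<^sup>2 \<le> 2 * B * norm (U (x k) - x k)"
      by linarith
    then show ?thesis
      using \<omega>(1) \<rho>(1) by (simp add: field_simps)
  qed
  have "(\<lambda>k. 2 * B / (\<omega> * \<rho>) * norm (U (x k) - x k)) \<longlonglongrightarrow> 0"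
    using tendsto_mult_right_zero[OF lim] by blast
  then have "(\<lambda>k. (norm (T i (x k) - x k))\<^sup>2) \<longlonglongrightarrow> 0"
    by (rule tendsto_sandwich[rotated 3]) (use upper in auto)
  then show ?thesis
    using tendsto_real_sqrt[of "\<lambda>k. (norm (T i (x k) - x k))\<^sup>2" 0] by simp
qed

lemma weakly_regular_over_average:
  assumes "bounded S" and reg: "\<And>i. i \<in> I \<Longrightarrow> weakly_regular_over S (T i)"
  shows "weakly_regular_over S U"
  unfolding weakly_regular_over_def
proof (intro conjI allI impI)
  show "S \<noteq> {}" using reg index_nonempty by (auto simp: weakly_regular_over_def)
  show "quasi_nonexpansive U" by (rule quasi_nonexpansive_average)
  fix x n y
  assume x: "range x \<subseteq> S \<and> strict_mono n \<and> weakly_tendsto (\<lambda>k. x (n k)) y \<and>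
    (\<lambda>k. norm (U (x k) - x k)) \<longlonglongrightarrow> 0"
  have "y \<in> Fix (T i)" if "i \<in> I" for i
  proof -
    have "(\<lambda>k. norm (T i (x k) - x k)) \<longlonglongrightarrow> 0"
      using displacement_tendsto_zero[OF \<open>bounded S\<close> _ that] x by blast
    then show ?thesis
      using reg[OF that] x unfolding weakly_regular_over_def by blast
  qed
  then show "y \<in> Fix U" by (simp add: Fix_average)
qed

lemma regular_over_average:
  assumes "bounded S" and reg: "\<And>i. i \<in> I \<Longrightarrow> regular_over S (T i)"
    and family: "family_regular_over S I (\<lambda>i. Fix (T i))"
  shows "regular_over S U"
  unfolding regular_over_def
proof (intro conjI allI impI)
  show "S \<noteq> {}" using family by (simp add: family_regular_over_def)
  show "quasi_nonexpansive U" by (rule quasi_nonexpansive_average)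
  fix x
  assume x: "range x \<subseteq> S \<and> (\<lambda>k. norm (U (x k) - x k)) \<longlonglongrightarrow> 0"
  have "(\<lambda>k. infdist (x k) (Fix (T i))) \<longlonglongrightarrow> 0" if "i \<in> I" for i
  proof -
    have "(\<lambda>k. norm (T i (x k) - x k)) \<longlonglongrightarrow> 0"
      using displacement_tendsto_zero[OF \<open>bounded S\<close> _ that] x by blast
    then show ?thesis
      using reg[OF that] x unfolding regular_over_def by blast
  qed
  then have "(\<lambda>k. MAX i\<in>I. infdist (x k) (Fix (T i))) \<longlonglongrightarrow> 0"
    by (intro tendsto_zero_MAX fin index_nonempty infdist_nonneg)
  then show "(\<lambda>k. infdist (x k) (Fix U)) \<longlonglongrightarrow> 0"
    using family x unfolding family_regular_over_def Fix_average by blast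
qed

text \<open>
  The modulus is quadratic in \<open>\<kappa> * \<delta>\<close> because the displacement bound controls the square
  of the displacements; its other side is linear in the distance from \<open>x\<close> to \<open>z\<close>, and taking the
  infimum over \<open>z\<close> turns that into the very distance to be estimated.
\<close>

lemma linearly_regular_over_average:
  assumes reg: "\<And>i. i \<in> I \<Longrightarrow> linearly_regular_over S (d i) (T i)"
    and d: "\<And>i. i \<in> I \<Longrightarrow> d i \<le> \<delta>"
    and family: "family_linearly_regular_over S \<kappa> I (\<lambda>i. Fix (T i))"
  shows "linearly_regular_over S (2 * \<kappa>\<^sup>2 * \<delta>\<^sup>2 / (\<omega> * \<rho>)) U"
proof -
  define C where "C = (\<Inter>i\<in>I. Fix (T i))"
  have "0 < \<kappa>" "S \<noteq> {}" using family by (auto simp: family_linearly_regular_over_def)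
  obtain j where "j \<in> I" using index_nonempty by blast
  then have "0 < \<delta>" using reg[of j] d[of j] by (simp add: linearly_regular_over_def)
  have "infdist x C \<le> 2 * \<kappa>\<^sup>2 * \<delta>\<^sup>2 / (\<omega> * \<rho>) * norm (U x - x)" if "x \<in> S" for x
  proof -
    define D where "D = infdist x C"
    have "(MAX i\<in>I. infdist x (Fix (T i))) \<in> (\<lambda>i. infdist x (Fix (T i))) ` I"
      using fin index_nonempty by (intro Max_in) auto
    then obtain i where i: "i \<in> I"
      and max: "(MAX i\<in>I. infdist x (Fix (T i))) = infdist x (Fix (T i))"
      by blast
    have "D \<le> \<kappa> * infdist x (Fix (T i))"
      using family \<open>x \<in> S\<close>
      unfolding family_linearly_regular_over_def D_def C_def max[symmetric] by blast
    also have "\<dots> \<le> \<kappa> * (d i * norm (T i x - x))"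
      using reg[OF i] \<open>x \<in> S\<close> \<open>0 < \<kappa>\<close> by (simp add: linearly_regular_over_def)
    also have "\<dots> \<le> \<kappa> * (\<delta> * norm (T i x - x))"
      using d[OF i] \<open>0 < \<kappa>\<close> by (intro mult_left_mono mult_right_mono) auto
    finally have "D\<^sup>2 \<le> (\<kappa> * (\<delta> * norm (T i x - x)))\<^sup>2"
      by (intro power_mono) (auto simp: D_def infdist_nonneg)
    also have "\<dots> = \<kappa>\<^sup>2 * \<delta>\<^sup>2 * (norm (T i x - x))\<^sup>2"
      by (simp add: power_mult_distrib)
    also have "\<dots> \<le> \<kappa>\<^sup>2 * \<delta>\<^sup>2 * (2 * norm (U x - x) / (\<omega> * \<rho>) * D)"
    proof (intro mult_left_mono)
      show "(norm (T i x - x))\<^sup>2 \<le> 2 * norm (U x - x) / (\<omega> * \<rho>) * D"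
        unfolding D_def
      proof (rule le_mult_infdist)
        show "C \<noteq> {}" using common by (simp add: C_def)
        show "0 \<le> 2 * norm (U x - x) / (\<omega> * \<rho>)" using \<omega>(1) \<rho>(1) by simp
        show "(norm (T i x - x))\<^sup>2 \<le> 2 * norm (U x - x) / (\<omega> * \<rho>) * dist x z" if "z \<in> C" for z
          using displacement_le[of z i x] that i \<omega>(1) \<rho>(1)
          by (simp add: C_def dist_norm field_simps)
      qed
    qed simp
    finally have "D * D \<le> 2 * \<kappa>\<^sup>2 * \<delta>\<^sup>2 / (\<omega> * \<rho>) * norm (U x - x) * D"
      by (simp add: power2_eq_square algebra_simps)
    moreover have "0 \<le> 2 * \<kappa>\<^sup>2 * \<delta>\<^sup>2 / (\<omega> * \<rho>) * norm (U x - x)"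
      using \<omega>(1) \<rho>(1) by simp
    moreover have "0 \<le> D" by (simp add: D_def infdist_nonneg)
    ultimately show ?thesis
      unfolding D_def[symmetric] by (metis mult_right_le_imp_le order_le_less)
  qed
  moreover have "0 < 2 * \<kappa>\<^sup>2 * \<delta>\<^sup>2 / (\<omega> * \<rho>)"
    using \<omega>(1) \<rho>(1) \<open>0 < \<kappa>\<close> \<open>0 < \<delta>\<close> by simp
  ultimately show ?thesis
    using \<open>S \<noteq> {}\<close> quasi_nonexpansive_average
    by (simp add: linearly_regular_over_def Fix_average C_def)
qed

end

theorem corollary5p3:
  fixes U\<^sub>i :: "nat \<Rightarrow> 'a::{real_inner, complete_space} \<Rightarrow> 'a"
    and U :: "'a \<Rightarrow> 'a"
    and m :: nat and I :: "nat set"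
    and \<rho>\<^sub>i \<omega>\<^sub>i :: "nat \<Rightarrow> real" and \<rho> \<omega> :: real
    and S :: "'a set"
  assumes I: "I = {1..m}"
    and U: "\<And>x. U x = (\<Sum>i\<in>I. \<omega>\<^sub>i i *\<^sub>R U\<^sub>i i x)"
    and sqne: "\<And>i. i \<in> I \<Longrightarrow> strongly_quasi_nonexpansive (\<rho>\<^sub>i i) (U\<^sub>i i)"
    and \<rho>: "\<rho> = (MIN i\<in>I. \<rho>\<^sub>i i)" "\<rho> > 0"
    and \<omega>: "\<omega> = (MIN i\<in>I. \<omega>\<^sub>i i)" "\<omega> > 0"
    and sum_\<omega>: "(\<Sum>i\<in>I. \<omega>\<^sub>i i) = 1"
    and F0: "(\<Inter>i\<in>I. Fix (U\<^sub>i i)) \<noteq> {}"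
    and S: "S \<noteq> {}" "bounded S"
  shows "((\<forall>i\<in>I. weakly_regular_over S (U\<^sub>i i)) \<longrightarrow> weakly_regular_over S U)
    \<and> ((\<forall>i\<in>I. regular_over S (U\<^sub>i i)) \<and> family_regular_over S I (\<lambda>i. Fix (U\<^sub>i i))
         \<longrightarrow> regular_over S U)
    \<and> (\<forall>(\<delta>\<^sub>i :: nat \<Rightarrow> real) (\<delta> :: real) (\<kappa> :: real).
         (\<forall>i\<in>I. linearly_regular_over S (\<delta>\<^sub>i i) (U\<^sub>i i)) \<and>
         \<delta> = (MAX i\<in>I. \<delta>\<^sub>i i) \<and> \<delta> > 0 \<and>
         \<kappa> > 0 \<and> family_linearly_regular_over S \<kappa> I (\<lambda>i. Fix (U\<^sub>i i))
         \<longrightarrow> linearly_regular_over S (2 * \<kappa>\<^sup>2 * \<delta>\<^sup>2 / (\<omega> * \<rho>)) U)"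
proof -
  have fin: "finite I" using I by simp
  have \<omega>_le: "\<omega> \<le> \<omega>\<^sub>i i" and \<rho>_le: "\<rho> \<le> \<rho>\<^sub>i i" if "i \<in> I" for i
    using fin that by (auto simp: \<omega>(1) \<rho>(1))
  note average = fin U sqne \<omega>(2) \<omega>_le \<rho>(2) \<rho>_le sum_\<omega> F0
  show ?thesis
  proof (intro conjI impI allI)
    assume "\<forall>i\<in>I. weakly_regular_over S (U\<^sub>i i)"
    then show "weakly_regular_over S U"
      by (intro weakly_regular_over_average[OF average S(2)]) auto
  next
    assume "(\<forall>i\<in>I. regular_over S (U\<^sub>i i)) \<and> family_regular_over S I (\<lambda>i. Fix (U\<^sub>i i))"
    then show "regular_over S U"
      by (intro regular_over_average[OF average S(2)]) auto
  next
    fix \<delta>\<^sub>i :: "nat \<Rightarrow> real" and \<delta> \<kappa> :: real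
    assume *: "(\<forall>i\<in>I. linearly_regular_over S (\<delta>\<^sub>i i) (U\<^sub>i i)) \<and>
      \<delta> = (MAX i\<in>I. \<delta>\<^sub>i i) \<and> \<delta> > 0 \<and>
      \<kappa> > 0 \<and> family_linearly_regular_over S \<kappa> I (\<lambda>i. Fix (U\<^sub>i i))"
    then have "\<delta>\<^sub>i i \<le> \<delta>" if "i \<in> I" for i
      using fin that by simp
    with * show "linearly_regular_over S (2 * \<kappa>\<^sup>2 * \<delta>\<^sup>2 / (\<omega> * \<rho>)) U"
      by (intro linearly_regular_over_average[OF average, where d = \<delta>\<^sub>i]) auto
  qed
qed

end
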